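(* Let $X$ be a nonempty set, $Y$ a nonempty subset of $X$, and $f,g\in\overline{\Omega}(X,Y)$. Then $(f,g)\in\mathcal{L}$ in $\overline{\Omega}(X,Y)$ if and only if $Xf=Xg$ and $|y(f_{\upharpoonright Y})^{-1}|=|y(g_{\upharpoonright Y})^{-1}|$ for all $y\in Y$.
   Context: $T(X)$ is the semigroup of all maps $X\to X$ under composition; maps are written on the right and composed from left to right, so $x(fg)=(xf)g$, and for $B\subseteq X$, $Bf=\{xf\colon x\in B\}$. Let $\overline{\Omega}(X,Y)=\{f\in T(X)\colon Yf=Y\}$, a subsemigroup of $T(X)$ containing the identity map. For $f\in\overline{\Omega}(X,Y)$, $f_{\upharpoonright Y}\colon Y\to Y$ denotes the (surjective) map that agrees with $f$ on $Y$, and for $y\in Y$, $y(f_{\upharpoonright Y})^{-1}=\{z\in Y\colon zf=y\}$. $|A|$ denotes the cardinality of $A$. $\mathcal{L}$ is Green's relation: for a semigroup $S$ with identity, $(a,b)\in\mathcal{L}$ iff $a=cb$ and $b=da$ for some $c,d\in S$. *)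

theory Defs
  imports "HOL-Algebra.Group" "HOL-Library.Equipollence"
begin

text \<open>
  The full transformation monoid \<open>T(X)\<close>.  Maps \<open>X \<rightarrow> X\<close> are the extensional functions on the
  carrier set \<open>X\<close> (fixed to be \<open>undefined\<close> outside \<open>X\<close>), so that equality of elements is equality
  of maps on \<open>X\<close>.  Maps act on the right and are composed from left to right: the product
  of \<open>f\<close> and \<open>g\<close> sends \<open>x\<close> to \<open>g (f x)\<close>.
\<close>

definition full_transf :: "'a set \<Rightarrow> ('a \<Rightarrow> 'a) monoid"
  where "full_transf X =
    \<lparr>carrier = X \<rightarrow>\<^sub>E X, mult = (\<lambda>f g. compose X g f), one = (\<lambda>x\<in>X. x)\<rparr>"

definition Omega_bar :: "'a set \<Rightarrow> 'a set \<Rightarrow> ('a \<Rightarrow> 'a) monoid"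
  where "Omega_bar X Y =
    (full_transf X)\<lparr>carrier := {f \<in> carrier (full_transf X). f ` Y = Y}\<rparr>"

definition green_L :: "('a, 'b) monoid_scheme \<Rightarrow> 'a rel"
  where "green_L S =
    {(a, b). a \<in> carrier S \<and> b \<in> carrier S \<and>
      (\<exists>c \<in> carrier S. \<exists>d \<in> carrier S. a = c \<otimes>\<^bsub>S\<^esub> b \<and> b = d \<otimes>\<^bsub>S\<^esub> a)}"

definition restr_fibre :: "('a \<Rightarrow> 'a) \<Rightarrow> 'a set \<Rightarrow> 'a \<Rightarrow> 'a set"
  where "restr_fibre f Y y = {z \<in> Y. restrict f Y z = y}"

lemma monoid_full_transf: "monoid (full_transf X)"
  by (rule monoidI)
    (auto simp: full_transf_def compose_def PiE_iff extensional_def fun_eq_iff)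

lemma submonoid_Omega_bar:
  assumes "Y \<subseteq> X"
  shows "submonoid (carrier (Omega_bar X Y)) (full_transf X)"
proof
  show "carrier (Omega_bar X Y) \<subseteq> carrier (full_transf X)"
    by (auto simp: Omega_bar_def)
next
  fix f g assume f: "f \<in> carrier (Omega_bar X Y)" and g: "g \<in> carrier (Omega_bar X Y)"
  have "compose X g f ` Y = g ` f ` Y"
    using assms by (force simp: compose_def)
  then show "f \<otimes>\<^bsub>full_transf X\<^esub> g \<in> carrier (Omega_bar X Y)"
    using f g by (auto simp: Omega_bar_def full_transf_def compose_def PiE_iff)
next
  have "(\<lambda>x\<in>X. x) ` Y = Y"
    using assms by force
  then show "\<one>\<^bsub>full_transf X\<^esub> \<in> carrier (Omega_bar X Y)"
    by (auto simp: Omega_bar_def full_transf_def)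
qed

lemma monoid_Omega_bar:
  assumes "Y \<subseteq> X"
  shows "monoid (Omega_bar X Y)"
  using submonoid.submonoid_is_monoid [OF submonoid_Omega_bar [OF assms] monoid_full_transf]
  by (simp add: Omega_bar_def)

end

theory Submission
  imports Defs
begin

text \<open>
  Green's relation \<open>\<L>\<close> is the equivalence induced by the left divisibility preorder, in which
  \<open>f\<close> lies below \<open>g\<close> when \<open>f = cg\<close> for some \<open>c\<close>. So it suffices to describe this
  preorder on the monoid of maps \<open>f\<close> with \<open>Yf = Y\<close>: one has \<open>f = cg\<close> exactly when
  \<open>Xf \<subseteq> Xg\<close> and each fibre of \<open>g\<close> restricted to \<open>Y\<close> has at most the cardinality of the
  corresponding fibre of \<open>f\<close> (lemma \<open>left_divisible_iff\<close>). The fibre condition arises because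
  a map \<open>c\<close> with \<open>f = cg\<close> and \<open>Yc \<subseteq> Y\<close> sends \<open>y(f\<restriction>Y)\<inverse>\<close> into \<open>y(g\<restriction>Y)\<inverse>\<close>, and \<open>Yc = Y\<close> holds
  precisely when all these maps between fibres are onto; conversely, a family of surjections between
  fibres glues to the restriction of such a \<open>c\<close> to \<open>Y\<close>.
  Taking the condition in both directions turns the inclusion of images into an equality, and the
  two comparisons of cardinalities into equipollence by the Schroeder--Bernstein theorem.
\<close>

lemma carrier_Omega_bar: "carrier (Omega_bar X Y) = {f \<in> X \<rightarrow>\<^sub>E X. f ` Y = Y}"
  by (simp add: Omega_bar_def full_transf_def)

lemma mult_Omega_bar: "c \<otimes>\<^bsub>Omega_bar X Y\<^esub> g = compose X g c"
  by (simp add: Omega_bar_def full_transf_def)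

lemma restr_fibre_eq: "restr_fibre f Y y = {z \<in> Y. f z = y}"
  by (auto simp: restr_fibre_def)

lemma image_fibre_of_left_factor:
  assumes "Y \<subseteq> X" and "c ` Y = Y" and "f = compose X g c"
  shows "c ` restr_fibre f Y y = restr_fibre g Y y"
proof
  show "c ` restr_fibre f Y y \<subseteq> restr_fibre g Y y"
    using assms by (auto simp: restr_fibre_eq compose_def)
next
  \<comment> \<open>A preimage in \<open>Y\<close> of a point of the fibre of \<open>g\<close> automatically lies in the fibre of \<open>f\<close>.\<close>
  show "restr_fibre g Y y \<subseteq> c ` restr_fibre f Y y"
  proof
    fix w assume w: "w \<in> restr_fibre g Y y"
    then have "w \<in> c ` Y"
      using assms(2) by (simp add: restr_fibre_eq)
    then obtain z where "z \<in> Y" "c z = w"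
      by blast
    then have "z \<in> restr_fibre f Y y"
      using w assms(1,3) by (auto simp: restr_fibre_eq compose_def)
    then show "w \<in> c ` restr_fibre f Y y"
      using \<open>c z = w\<close> by blast
  qed
qed

text \<open>
  On \<open>Y\<close> the factor has to follow the given surjections between fibres, so that it maps \<open>Y\<close> onto
  \<open>Y\<close>; outside \<open>Y\<close> it may be any choice of preimages under \<open>g\<close>.
\<close>

lemma left_factor_of_fibre_surjections:
  assumes "Y \<subseteq> X"
    and f: "f \<in> carrier (Omega_bar X Y)" and g: "g \<in> carrier (Omega_bar X Y)"
    and img: "f ` X \<subseteq> g ` X"
    and s: "\<And>y. y \<in> Y \<Longrightarrow> s y ` restr_fibre f Y y = restr_fibre g Y y"
  obtains c where "c \<in> carrier (Omega_bar X Y)" and "f = c \<otimes>\<^bsub>Omega_bar X Y\<^esub> g"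
proof -
  have fX: "f \<in> X \<rightarrow>\<^sub>E X" and fY: "f ` Y = Y" and gY: "g ` Y = Y"
    using f g by (auto simp: carrier_Omega_bar)
  define c where "c = (\<lambda>x\<in>X. if x \<in> Y then s (f x) x else inv_into X g (f x))"
  have cY: "c x \<in> Y \<and> g (c x) = f x" if "x \<in> Y" for x
  proof -
    have "f x \<in> Y" and "x \<in> restr_fibre f Y (f x)"
      using that fY by (auto simp: restr_fibre_eq)
    then have "s (f x) x \<in> restr_fibre g Y (f x)"
      using s by blast
    then show ?thesis
      using that \<open>Y \<subseteq> X\<close> by (auto simp: c_def restr_fibre_eq)
  qed
  have c_out: "c x \<in> X \<and> g (c x) = f x" if "x \<in> X" "x \<notin> Y" for x
    using that img by (auto simp: c_def inv_into_into f_inv_into_f image_subset_iff)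
  have "Y \<subseteq> c ` Y"
  proof
    fix w assume "w \<in> Y"
    then have "g w \<in> Y" and "w \<in> restr_fibre g Y (g w)"
      using gY by (auto simp: restr_fibre_eq)
    then obtain z where z: "z \<in> restr_fibre f Y (g w)" and "w = s (g w) z"
      using s by blast
    then have "c z = w" "z \<in> Y"
      using \<open>Y \<subseteq> X\<close> by (auto simp: c_def restr_fibre_eq)
    then show "w \<in> c ` Y"
      by blast
  qed
  then have "c ` Y = Y"
    using cY by blast
  moreover have "c \<in> X \<rightarrow>\<^sub>E X"
    using cY c_out \<open>Y \<subseteq> X\<close> by (fastforce simp: c_def)
  moreover have "f = compose X g c"
  proof (rule extensionalityI)
    show "f \<in> extensional X" using fX by (simp add: PiE_iff)
    show "compose X g c \<in> extensional X" by simp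
    show "f x = compose X g c x" if "x \<in> X" for x
      using that cY [of x] c_out [of x] by (cases "x \<in> Y") (simp_all add: compose_eq)
  qed
  ultimately show thesis
    by (intro that) (simp_all add: carrier_Omega_bar mult_Omega_bar)
qed

text \<open>
  A surjection between fibres may be traded for a comparison of cardinalities in the opposite
  direction, because \<open>Yg = Y\<close> makes every fibre of \<open>g\<close> over \<open>Y\<close> nonempty.
\<close>

lemma left_divisible_iff:
  assumes "Y \<subseteq> X"
    and f: "f \<in> carrier (Omega_bar X Y)" and g: "g \<in> carrier (Omega_bar X Y)"
  shows "(\<exists>c\<in>carrier (Omega_bar X Y). f = c \<otimes>\<^bsub>Omega_bar X Y\<^esub> g) \<longleftrightarrow>
    f ` X \<subseteq> g ` X \<and> (\<forall>y\<in>Y. restr_fibre g Y y \<lesssim> restr_fibre f Y y)"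
    (is "?L \<longleftrightarrow> ?R")
proof
  assume ?L
  then obtain c where c: "c \<in> X \<rightarrow>\<^sub>E X" "c ` Y = Y" and fc: "f = compose X g c"
    by (auto simp: carrier_Omega_bar mult_Omega_bar)
  have "f ` X \<subseteq> g ` X"
    using c(1) unfolding fc by (auto simp: compose_eq)
  moreover have "restr_fibre g Y y \<lesssim> restr_fibre f Y y" for y
    using image_fibre_of_left_factor [OF \<open>Y \<subseteq> X\<close> c(2) fc] by (metis image_lepoll)
  ultimately show ?R
    by blast
next
  assume R: ?R
  have "\<exists>s. s ` restr_fibre f Y y = restr_fibre g Y y" if "y \<in> Y" for y
  proof -
    have "restr_fibre g Y y \<noteq> {}"
      using that g by (force simp: carrier_Omega_bar restr_fibre_eq)
    then show ?thesis
      using R that inj_on_iff_surj unfolding lepoll_def by metis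
  qed
  then obtain s where "\<And>y. y \<in> Y \<Longrightarrow> s y ` restr_fibre f Y y = restr_fibre g Y y"
    by metis
  then show ?L
    using left_factor_of_fibre_surjections [OF assms] R by metis
qed

theorem theorem4p2:
  fixes X Y :: "'a set" and f g :: "'a \<Rightarrow> 'a"
  assumes "X \<noteq> {}" and "Y \<noteq> {}" and "Y \<subseteq> X"
    and "f \<in> carrier (Omega_bar X Y)" and "g \<in> carrier (Omega_bar X Y)"
  shows "(f, g) \<in> green_L (Omega_bar X Y) \<longleftrightarrow>
    f ` X = g ` X \<and> (\<forall>y\<in>Y. restr_fibre f Y y \<approx> restr_fibre g Y y)"
proof -
  let ?S = "Omega_bar X Y"
  have "(f, g) \<in> green_L ?S \<longleftrightarrow>
      (\<exists>c\<in>carrier ?S. f = c \<otimes>\<^bsub>?S\<^esub> g) \<and> (\<exists>d\<in>carrier ?S. g = d \<otimes>\<^bsub>?S\<^esub> f)"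
    using assms(4,5) by (auto simp: green_L_def)
  also have "\<dots> \<longleftrightarrow> (f ` X \<subseteq> g ` X \<and> (\<forall>y\<in>Y. restr_fibre g Y y \<lesssim> restr_fibre f Y y)) \<and>
      (g ` X \<subseteq> f ` X \<and> (\<forall>y\<in>Y. restr_fibre f Y y \<lesssim> restr_fibre g Y y))"
    using left_divisible_iff [OF assms(3,4,5)] left_divisible_iff [OF assms(3,5,4)] by simp
  also have "\<dots> \<longleftrightarrow> f ` X = g ` X \<and> (\<forall>y\<in>Y. restr_fibre f Y y \<approx> restr_fibre g Y y)"
    by (blast intro: lepoll_antisym eqpoll_imp_lepoll eqpoll_sym)
  finally show ?thesis .
qed

end
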